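(* Let $K\subset\mathbb R^n$ be a convex body and let $H$ be the set of normals of $K$. Then the Carathéodory number for $K$-strong convexity is at least the Carathéodory number for $H$-convexity (values may be $\infty$).
   Context: A convex body is a compact convex set with nonempty interior. The set of normals $H\subseteq\mathbb S^{n-1}$ of a convex body $K$ is the set of outer unit normals of $K$ at its regular boundary points (boundary points with a unique supporting hyperplane); for a polytope these are the outer unit normals of its facets. $H$-convexity: a set in $\mathbb R^n$ is $H$-convex if it is an intersection of closed halfspaces $\{x:\langle a,x\rangle\le b\}$ with $a\in H$, $b\in\mathbb R$. The $H$-convex hull $\operatorname{conv}_H X$ is the minimal $H$-convex set containing $X$ (the intersection of all such halfspaces containing $X$). The Carathéodory number for $H$-convexity is the smallest number $h$ such that for every closed set $X\subseteq\mathbb R^n$, $\operatorname{conv}_H X=\bigcup_{X'\subseteq X,\ |X'|\le h}\operatorname{conv}_H X'$; it is $\infty$ if there is no such finite $h$. $K$-strong convexity: a set is $K$-strongly convex if it is an intersection of translates of $K$. For $X$ contained in some translate of $K$, the hull $\operatorname{conv}_K X$ is the minimal $K$-strongly convex set containing $X$, i.e. the intersection of all translates of $K$ containing $X$. The Carathéodory number for $K$-strong convexity is the smallest number $k$ such that for every closed set $X$ contained in a translate of $K$, $\operatorname{conv}_K X=\bigcup_{X'\subseteq X,\ |X'|\le k}\operatorname{conv}_K X'$; it is $\infty$ if there is no such finite $k$.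
   Formalization: In the Carathéodory number for H-convexity, X ranges over closed bounded sets rather than all closed sets; with unbounded closed X that number is infinite for every convex body in dimension at least 2, and the claim fails, for example, for a square. *)

theory Defs
  imports "HOL-Analysis.Analysis" "HOL-Library.Extended_Nat"
begin

definition convex_body :: "'a::euclidean_space set \<Rightarrow> bool" where
  "convex_body K \<longleftrightarrow> compact K \<and> convex K \<and> interior K \<noteq> {}"

definition outer_unit_normal :: "'a::euclidean_space set \<Rightarrow> 'a \<Rightarrow> 'a \<Rightarrow> bool" where
  "outer_unit_normal K p a \<longleftrightarrow> norm a = 1 \<and> (\<forall>x\<in>K. a \<bullet> x \<le> a \<bullet> p)"

definition supporting_hyperplane_at :: "'a::euclidean_space set \<Rightarrow> 'a \<Rightarrow> 'a set \<Rightarrow> bool" where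
  "supporting_hyperplane_at K p P \<longleftrightarrow>
     p \<in> P \<and> (\<exists>a b. a \<noteq> 0 \<and> P = {x. a \<bullet> x = b} \<and> K \<subseteq> {x. a \<bullet> x \<le> b})"

definition regular_boundary_point :: "'a::euclidean_space set \<Rightarrow> 'a \<Rightarrow> bool" where
  "regular_boundary_point K p \<longleftrightarrow> p \<in> frontier K \<and> (\<exists>!P. supporting_hyperplane_at K p P)"

definition normals :: "'a::euclidean_space set \<Rightarrow> 'a set" where
  "normals K = {a. \<exists>p. regular_boundary_point K p \<and> outer_unit_normal K p a}"

text \<open>Empty intersections are allowed in the two convexity notions below, so the whole space is
  convex in both senses; hence the hull of a set that no halfspace with normal in \<open>H\<close>
  (respectively no translate of \<open>K\<close>) contains is the whole space.\<close>

definition H_convex :: "'a::euclidean_space set \<Rightarrow> 'a set \<Rightarrow> bool" where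
  "H_convex H C \<longleftrightarrow> (\<exists>F. F \<subseteq> {{x. a \<bullet> x \<le> b} | a b. a \<in> H} \<and> C = \<Inter>F)"

definition conv_H :: "'a::euclidean_space set \<Rightarrow> 'a set \<Rightarrow> 'a set" where
  "conv_H H X = H_convex H hull X"

definition strongly_convex :: "'a::euclidean_space set \<Rightarrow> 'a set \<Rightarrow> bool" where
  "strongly_convex K C \<longleftrightarrow> (\<exists>T. C = (\<Inter>t\<in>T. (+) t ` K))"

definition conv_K :: "'a::euclidean_space set \<Rightarrow> 'a set \<Rightarrow> 'a set" where
  "conv_K K X = strongly_convex K hull X"

text \<open>The infimum of the empty set of extended naturals is \<open>\<infinity>\<close>.\<close>

definition caratheodory_number :: "('a set \<Rightarrow> bool) \<Rightarrow> ('a set \<Rightarrow> 'a set) \<Rightarrow> enat" where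
  "caratheodory_number P cnv =
     Inf {enat k | k. \<forall>X. P X \<longrightarrow>
       cnv X = (\<Union>X'\<in>{X'. X' \<subseteq> X \<and> finite X' \<and> card X' \<le> k}. cnv X')}"

text \<open>In \<open>caratheodory_number_H\<close> the sets \<open>X\<close> are closed and bounded. Unbounded closed sets have
  to be excluded: in dimension at least 2, for a unit vector \<open>a\<close> in \<open>H\<close>, the closed set of all
  \<open>y - (1 / norm y) *\<^sub>R a\<close> with \<open>y \<noteq> 0\<close> orthogonal to \<open>a\<close> has \<open>0\<close> in its hull, but not in the hull
  of any of its finite subsets. Ranging over all closed sets would therefore make the number
  infinite for every convex body, and it would exceed the number for strong convexity already
  for a square. In \<open>caratheodory_number_K\<close> boundedness is automatic.\<close>

definition caratheodory_number_H :: "'a::euclidean_space set \<Rightarrow> enat" where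
  "caratheodory_number_H H = caratheodory_number (\<lambda>X. closed X \<and> bounded X) (conv_H H)"

definition caratheodory_number_K :: "'a::euclidean_space set \<Rightarrow> enat" where
  "caratheodory_number_K K =
     caratheodory_number (\<lambda>X. closed X \<and> (\<exists>t. X \<subseteq> (+) t ` K)) (conv_K K)"

lemma conv_H_eq: "conv_H H X = \<Inter>{{x. a \<bullet> x \<le> b} | a b. a \<in> H \<and> X \<subseteq> {x. a \<bullet> x \<le> b}}"
    (is "_ = ?R")
proof
  have "H_convex H ?R"
    unfolding H_convex_def
    by (rule exI[of _ "{{x. a \<bullet> x \<le> b} | a b. a \<in> H \<and> X \<subseteq> {x. a \<bullet> x \<le> b}}"]) blast
  moreover have "X \<subseteq> ?R" by blast
  ultimately show "conv_H H X \<subseteq> ?R"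
    unfolding conv_H_def by (simp add: hull_minimal)
next
  show "?R \<subseteq> conv_H H X"
  proof -
    have "?R \<subseteq> C" if C: "H_convex H C" "X \<subseteq> C" for C
    proof -
      obtain F where F: "F \<subseteq> {{x. a \<bullet> x \<le> b} | a b. a \<in> H}" "C = \<Inter>F"
        using C unfolding H_convex_def by blast
      have "?R \<subseteq> S" if S: "S \<in> F" for S
      proof -
        have "X \<subseteq> S" using C F S by blast
        moreover obtain a b where "S = {x. a \<bullet> x \<le> b}" "a \<in> H" using F(1) S by blast
        ultimately show ?thesis by blast
      qed
      then show ?thesis using F by blast
    qed
    then show ?thesis unfolding conv_H_def hull_def by blast
  qed
qed

lemma conv_K_eq: "conv_K K X = (\<Inter>t\<in>{t. X \<subseteq> (+) t ` K}. (+) t ` K)" (is "_ = ?R")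
proof
  have "strongly_convex K ?R" unfolding strongly_convex_def by blast
  moreover have "X \<subseteq> ?R" by blast
  ultimately show "conv_K K X \<subseteq> ?R"
    unfolding conv_K_def by (simp add: hull_minimal)
next
  have "?R \<subseteq> C" if C: "strongly_convex K C" "X \<subseteq> C" for C
  proof -
    obtain T where T: "C = (\<Inter>t\<in>T. (+) t ` K)" using C unfolding strongly_convex_def by blast
    then have "T \<subseteq> {t. X \<subseteq> (+) t ` K}" using C by blast
    then show ?thesis unfolding T by blast
  qed
  then show "?R \<subseteq> conv_K K X" unfolding conv_K_def hull_def by blast
qed

end

theory Submission
  imports Defs
begin

text \<open>
  Shrinking a set \<open>X\<close> while keeping \<open>K\<close> amounts to keeping \<open>X\<close> and enlarging \<open>K\<close>, and large copies
  of \<open>K\<close> look like halfspaces near the regular boundary points. So the \<open>K\<close>-strong hulls of small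
  copies of \<open>X\<close> should approach small copies of the \<open>H\<close>-convex hull of \<open>X\<close>, where \<open>H\<close> is the set of
  normals of \<open>K\<close>. The proof makes both directions of this approximation precise.

  On the one hand, \<open>K\<close> is itself an intersection of halfspaces with normals in \<open>H\<close>
  (\<open>convex_body_separation_by_normal\<close>). Therefore every translate of \<open>K\<close> is \<open>H\<close>-convex, and
  \<open>p \<in> conv_H H X\<close> implies \<open>\<epsilon> *\<^sub>R p \<in> conv_K K (\<epsilon> X)\<close> for all \<open>\<epsilon> > 0\<close>
  (\<open>conv_H_scaled_in_conv_K\<close>).

  On the other hand, let \<open>k\<close> have the Caratheodory property for \<open>K\<close>-strong convexity, let \<open>X\<close> be
  compact and \<open>p \<in> conv_H H X\<close>. For all small \<open>\<epsilon>\<close> the set \<open>\<epsilon> X\<close> fits into a translate of \<open>K\<close>, so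
  there are \<open>k\<close> points of \<open>X\<close>, depending on \<open>\<epsilon>\<close>, whose \<open>\<epsilon>\<close>-copies have \<open>\<epsilon> *\<^sub>R p\<close> in their
  \<open>K\<close>-strong hull. As \<open>\<epsilon>\<close> tends to \<open>0\<close>, a subsequence of these \<open>k\<close>-tuples converges in \<open>X\<close>, and \<open>p\<close>
  lies in the \<open>H\<close>-convex hull of the limit points (\<open>conv_H_of_limit_of_conv_K\<close>). Indeed, a halfspace
  with normal \<open>a \<in> H\<close> that contained the limit points but not \<open>p\<close> could be replaced, for small \<open>\<epsilon>\<close>,
  by a copy of \<open>K\<close> enlarged around a regular boundary point with normal \<open>a\<close>. Hence \<open>k\<close> has the
  Caratheodory property for \<open>H\<close>-convexity as well.
\<close>

section \<open>Separation by normals at regular boundary points\<close>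

text \<open>
  The separating hyperplane of \<open>interior K\<close> and \<open>T\<close> also bounds \<open>K\<close>, because \<open>K\<close> lies in the closure
  of its interior.
\<close>
lemma convex_supporting_separation:
  fixes K T :: "'a::euclidean_space set"
  assumes "convex K" "interior K \<noteq> {}" "convex T" "T \<noteq> {}" "T \<inter> interior K = {}"
  obtains a b where "a \<noteq> 0" "\<And>x. x \<in> K \<Longrightarrow> a \<bullet> x \<le> b" "\<And>x. x \<in> T \<Longrightarrow> b \<le> a \<bullet> x"
proof -
  obtain a b where ab: "a \<noteq> 0" "\<forall>x\<in>interior K. a \<bullet> x \<le> b" "\<forall>x\<in>T. a \<bullet> x \<ge> b"
    using separating_hyperplane_sets[of "interior K" T] assms
    by (auto simp: convex_interior Int_commute)
  have "closure (interior K) \<subseteq> {x. a \<bullet> x \<le> b}"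
    using ab(2) by (intro closure_minimal) (auto simp: closed_halfspace_le)
  then have "K \<subseteq> {x. a \<bullet> x \<le> b}"
    using convex_closure_interior[OF assms(1,2)] closure_subset by blast
  with ab that show thesis by blast
qed

text \<open>
  The hyperplane supports the ball as well, and a ball has only one supporting hyperplane at a
  boundary point. Algebraically this is the equality case of the Cauchy-Schwarz inequality for
  \<open>a\<close> and \<open>p - c\<close>.
\<close>
lemma touching_ball_normal:
  fixes K :: "'a::euclidean_space set"
  assumes ball: "cball c e \<subseteq> K" "e > 0" "p \<in> cball c e"
    and a: "a \<noteq> 0" "\<And>x. x \<in> K \<Longrightarrow> a \<bullet> x \<le> a \<bullet> p"
  shows "p - c = (e / norm a) *\<^sub>R a"
proof -
  have "c + (e / norm a) *\<^sub>R a \<in> cball c e"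
    using ball(2) a(1) by (simp add: dist_norm)
  then have "a \<bullet> (c + (e / norm a) *\<^sub>R a) \<le> a \<bullet> p" using ball(1) a(2) by blast
  then have 1: "e * norm a \<le> a \<bullet> (p - c)"
    using a(1) by (simp add: algebra_simps power2_norm_eq_inner[symmetric] power2_eq_square)
  have 2: "norm (p - c) \<le> e" using ball(3) by (simp add: dist_norm norm_minus_commute)
  have 3: "a \<bullet> (p - c) \<le> norm a * norm (p - c)" by (rule norm_cauchy_schwarz)
  have "norm a * norm (p - c) \<le> e * norm a"
    unfolding mult.commute[of e] using 2 by (intro mult_left_mono) auto
  with 1 3 have "a \<bullet> (p - c) = norm a * norm (p - c)" "norm a * norm (p - c) = e * norm a"
    by linarith+
  then have "norm a *\<^sub>R (p - c) = norm (p - c) *\<^sub>R a" "norm (p - c) = e"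
    using a(1) norm_cauchy_schwarz_eq[THEN iffD1, of a "p - c"] by (blast, simp)
  then have "norm a *\<^sub>R (p - c) = e *\<^sub>R a" by simp
  then have "(1 / norm a) *\<^sub>R (norm a *\<^sub>R (p - c)) = (1 / norm a) *\<^sub>R (e *\<^sub>R a)" by simp
  then show ?thesis using a(1) by simp
qed

text \<open>
  Boundary points that are touched from inside by a ball provide the regular points: any two
  supporting hyperplanes there are orthogonal to the same radius of the ball.
\<close>
lemma touching_ball_in_normals:
  fixes K :: "'a::euclidean_space set"
  assumes K: "convex_body K"
    and ball: "cball c e \<subseteq> K" "e > 0" "p \<in> cball c e" and p: "p \<in> frontier K"
  obtains a where "a \<in> normals K" "norm a = 1" "p = c + e *\<^sub>R a" "\<And>x. x \<in> K \<Longrightarrow> a \<bullet> x \<le> a \<bullet> p"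
proof -
  have K': "convex K" "interior K \<noteq> {}" using K by (auto simp: convex_body_def)
  have pK: "p \<in> K" "p \<notin> interior K"
    using ball p by (auto simp: frontier_def)
  obtain a b where ab: "a \<noteq> 0" "\<And>x. x \<in> K \<Longrightarrow> a \<bullet> x \<le> b" "b \<le> a \<bullet> p"
    using convex_supporting_separation[OF K', of "{p}"] pK by auto
  have b: "b = a \<bullet> p" using ab(3) ab(2)[OF pK(1)] by simp
  define u where "u = sgn a"
  have u: "norm u = 1" "\<And>x. x \<in> K \<Longrightarrow> u \<bullet> x \<le> u \<bullet> p"
    using ab unfolding b by (auto simp: u_def norm_sgn sgn_div_norm divide_right_mono)
  have pc: "p - c = e *\<^sub>R u"
    using touching_ball_normal[OF ball, of u] u by fastforce
  have "supporting_hyperplane_at K p {x. u \<bullet> x = u \<bullet> p}"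
    unfolding supporting_hyperplane_at_def
  proof (intro conjI exI)
    show "u \<noteq> 0" using u(1) by auto
    show "K \<subseteq> {x. u \<bullet> x \<le> u \<bullet> p}" using u(2) by blast
  qed simp_all
  moreover have "P = {x. u \<bullet> x = u \<bullet> p}" if P: "supporting_hyperplane_at K p P" for P
  proof -
    obtain v \<beta> where v: "p \<in> P" "v \<noteq> 0" "P = {x. v \<bullet> x = \<beta>}" "K \<subseteq> {x. v \<bullet> x \<le> \<beta>}"
      using P unfolding supporting_hyperplane_at_def by (elim conjE exE) (rule that)
    have \<beta>: "\<beta> = v \<bullet> p" using v(1,3) by simp
    have "v \<bullet> x \<le> v \<bullet> p" if "x \<in> K" for x using v(4) that unfolding \<beta> by blast
    then have "p - c = (e / norm v) *\<^sub>R v" by (rule touching_ball_normal[OF ball v(2)])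
    with pc have "(norm v / e) *\<^sub>R (e *\<^sub>R u) = (norm v / e) *\<^sub>R ((e / norm v) *\<^sub>R v)" by simp
    then have "norm v *\<^sub>R u = v" using v(2) ball(2) by simp
    then have "v \<bullet> x = norm v * (u \<bullet> x)" for x by (metis inner_scaleR_left)
    then show ?thesis using v(2,3) \<beta> by simp
  qed
  ultimately have "regular_boundary_point K p"
    unfolding regular_boundary_point_def using p by blast
  then have "u \<in> normals K" using u unfolding normals_def outer_unit_normal_def by blast
  moreover have "p = c + e *\<^sub>R u" using pc by (simp add: algebra_simps)
  ultimately show thesis using that u by blast
qed

text \<open>
  A ball slid from \<open>z\<close> towards the outside point \<open>y\<close> must hit the frontier of \<open>K\<close> at the last position
  at which it is still inside: otherwise compactness leaves room for a further step.
\<close>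
lemma segment_ball_touches_frontier:
  fixes K :: "'a::euclidean_space set"
  assumes K: "compact K" and z: "cball z e \<subseteq> K" and y: "y \<notin> K" and e: "e > 0"
  obtains s p where "0 \<le> s" "s < 1" "cball (z + s *\<^sub>R (y - z)) e \<subseteq> K"
    "p \<in> cball (z + s *\<^sub>R (y - z)) e" "p \<in> frontier K"
proof -
  define c where "c s = z + s *\<^sub>R (y - z)" for s :: real
  define S where "S = {0..1} \<inter> (\<Inter>v\<in>cball 0 e. (\<lambda>s. c s + v) -` K)"
  have S_iff: "s \<in> S \<longleftrightarrow> 0 \<le> s \<and> s \<le> 1 \<and> cball (c s) e \<subseteq> K" for s
  proof -
    have "cball (c s) e = (+) (c s) ` cball 0 e" by simp
    then have "cball (c s) e \<subseteq> K \<longleftrightarrow> (\<forall>v\<in>cball 0 e. c s + v \<in> K)"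
      by (simp only: image_subset_iff)
    then show ?thesis by (simp only: S_def Int_iff INT_iff vimage_eq atLeastAtMost_iff conj_assoc)
  qed
  have "closed ((\<lambda>s. c s + v) -` K)" for v
    unfolding c_def using K by (intro continuous_closed_vimage continuous_intros compact_imp_closed)
  then have "compact S" unfolding S_def by (intro compact_Int_closed) auto
  moreover have "0 \<in> S" using z by (simp add: S_iff c_def)
  ultimately obtain s where s: "s \<in> S" "\<And>t. t \<in> S \<Longrightarrow> t \<le> s"
    using compact_attains_sup by (metis empty_iff)
  have "c s \<in> K" using s(1) e by (auto simp: S_iff)
  then have "s \<noteq> 1" using y by (auto simp: c_def)
  then have s01: "0 \<le> s" "s < 1" "cball (c s) e \<subseteq> K" using s(1) by (auto simp: S_iff)
  have "cball (c s) e \<inter> frontier K \<noteq> {}"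
  proof
    assume "cball (c s) e \<inter> frontier K = {}"
    then have "cball (c s) e \<subseteq> interior K"
      using s01(3) closure_subset by (fastforce simp: frontier_def)
    then obtain d where d: "d > 0" "(\<Union>x\<in>cball (c s) e. ball x d) \<subseteq> interior K"
      using compact_subset_open_imp_ball_epsilon_subset[of "cball (c s) e" "interior K"] by auto
    have L: "norm (y - z) > 0" using y z e by (force simp: subset_iff)
    define h where "h = min (1 - s) (d / (2 * norm (y - z)))"
    have h: "h > 0" "s + h \<le> 1" "h * norm (y - z) < d"
    proof -
      have "h * norm (y - z) \<le> d / (2 * norm (y - z)) * norm (y - z)"
        using L by (intro mult_right_mono) (auto simp: h_def)
      then show "h * norm (y - z) < d" using L d by simp
    qed (use L d s01 in \<open>auto simp: h_def\<close>)
    have "cball (c (s + h)) e \<subseteq> K"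
    proof
      fix x assume x: "x \<in> cball (c (s + h)) e"
      define x' where "x' = x - h *\<^sub>R (y - z)"
      have "dist (c s) x' = dist (c (s + h)) x"
        by (simp add: x'_def c_def dist_norm algebra_simps)
      moreover have "x \<in> ball x' d" using h by (simp add: x'_def dist_norm)
      ultimately show "x \<in> K" using d(2) x interior_subset by fastforce
    qed
    then have "s + h \<in> S" using h s01 by (auto simp: S_iff)
    then show False using s(2) h(1) by fastforce
  qed
  then show thesis using that[of s] s01 unfolding c_def by blast
qed

text \<open>
  A small ball of radius \<open>e\<close> slides from an inner point \<open>z\<close> of \<open>K\<close> towards \<open>y\<close>; where it gets stuck it
  touches a regular boundary point with some normal \<open>a\<close>. Since the larger ball of radius \<open>r\<close>
  around \<open>z\<close> lies in \<open>K\<close>, the direction \<open>y - z\<close> has a component of at least \<open>r / 2\<close> along \<open>a\<close>. The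
  centre of the stuck ball still has a definite distance to \<open>y\<close>, so travelling the rest of the way
  gains more than \<open>e\<close> in direction \<open>a\<close> and crosses the supporting hyperplane.
\<close>
lemma convex_body_separation_by_normal:
  fixes K :: "'a::euclidean_space set"
  assumes K: "convex_body K" and y: "y \<notin> K"
  obtains a b where "a \<in> normals K" "\<And>x. x \<in> K \<Longrightarrow> a \<bullet> x \<le> b" "b < a \<bullet> y"
proof -
  have cK: "compact K" "closed K" using K by (auto simp: convex_body_def compact_imp_closed)
  obtain z r where z: "r > 0" "cball z r \<subseteq> K"
    using K unfolding convex_body_def by (metis ex_in_conv mem_interior_cball)
  obtain d where d: "d > 0" "ball y d \<subseteq> - K"
    using cK y open_contains_ball[of "- K"] by auto
  define L where "L = norm (y - z)"
  have L: "L > 0" using y z by (force simp: L_def subset_iff)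
  \<comment> \<open>The remaining part of the segment is at least the fraction \<open>d / L\<close> of it, and it gains at least
    \<open>d / L * (r / 2)\<close> in the direction of the normal; this has to exceed \<open>e\<close>.\<close>
  define e where "e = min (r / 2) (d * r / (4 * L))"
  have e: "e > 0" "e \<le> r / 2" "e < d / L * (r / 2)"
  proof -
    have "d * r / (4 * L) < d / L * (r / 2)" using z d L by (simp add: field_simps)
    then show "e < d / L * (r / 2)" by (simp add: e_def)
  qed (use z d L in \<open>auto simp: e_def\<close>)
  have "cball z e \<subseteq> K" using z subset_cball[of e r z] e by simp
  then obtain s p where s: "0 \<le> s" "s < 1" "cball (z + s *\<^sub>R (y - z)) e \<subseteq> K"
    "p \<in> cball (z + s *\<^sub>R (y - z)) e" "p \<in> frontier K"
    using segment_ball_touches_frontier[OF cK(1) _ y e(1)] by blast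
  obtain a where a: "a \<in> normals K" "norm a = 1" "p = z + s *\<^sub>R (y - z) + e *\<^sub>R a"
      "\<And>x. x \<in> K \<Longrightarrow> a \<bullet> x \<le> a \<bullet> p"
    using touching_ball_in_normals[OF K s(3) e(1) s(4,5)] by blast
  have aa: "a \<bullet> a = 1" using a(2) by (simp add: norm_eq_1)
  have ap: "a \<bullet> p = a \<bullet> z + s * (a \<bullet> (y - z)) + e"
    by (simp add: a(3) inner_add_right aa)
  have "z + r *\<^sub>R a \<in> K" using z a(2) by (auto simp: subset_iff dist_norm)
  from a(4)[OF this] have 1: "r / 2 \<le> s * (a \<bullet> (y - z))"
    unfolding ap using e(2) by (simp add: inner_add_right aa)
  then have pos: "a \<bullet> (y - z) > 0" using z(1) s(1)
    by (smt (verit) mult_nonneg_nonpos half_gt_zero)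
  then have 2: "r / 2 \<le> a \<bullet> (y - z)" using 1 s(1,2)
    by (smt (verit) mult_left_le_one_le)
  have "z + s *\<^sub>R (y - z) \<in> K" using s(3) e(1) by auto
  then have "z + s *\<^sub>R (y - z) \<notin> ball y d" using d(2) by blast
  moreover have "y - (z + s *\<^sub>R (y - z)) = (1 - s) *\<^sub>R (y - z)" by (simp add: algebra_simps)
  ultimately have "d \<le> (1 - s) * L" using s by (simp add: dist_norm L_def)
  then have "d / L \<le> 1 - s" using L by (simp add: field_simps)
  then have "d / L * (r / 2) \<le> (1 - s) * (a \<bullet> (y - z))"
    using 2 d L z s by (intro mult_mono) auto
  then have "a \<bullet> p < a \<bullet> y" unfolding ap using e(3) by (simp add: algebra_simps)
  then show thesis using that a by blast
qed

section \<open>Enlarged copies of the body at a regular boundary point\<close>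

text \<open>
  If the ray from \<open>q\<close> in direction \<open>v\<close> missed the interior, a hyperplane through \<open>q\<close> would separate the
  two. By regularity it is the one with normal \<open>a\<close>, but then \<open>K\<close> would lie on both sides of it.
\<close>
lemma regular_point_inward_direction:
  fixes K :: "'a::euclidean_space set"
  assumes K: "convex_body K" and q: "regular_boundary_point K q" and a: "outer_unit_normal K q a"
    and v: "a \<bullet> v < 0"
  shows "\<exists>\<mu>>0. q + \<mu> *\<^sub>R v \<in> interior K"
proof (rule ccontr)
  assume "\<not> (\<exists>\<mu>>0. q + \<mu> *\<^sub>R v \<in> interior K)"
  then have out: "q + \<mu> *\<^sub>R v \<notin> interior K" if "\<mu> > 0" for \<mu> using that by blast
  have K': "convex K" "interior K \<noteq> {}" "closed K"
    using K by (auto simp: convex_body_def compact_imp_closed)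
  have qK: "q \<in> K" using q K'(3) by (auto simp: regular_boundary_point_def frontier_def)
  define T where "T = (\<lambda>\<mu>. q + \<mu> *\<^sub>R v) ` {0<..}"
  have "T = (+) q ` ((\<lambda>\<mu>. \<mu> *\<^sub>R v) ` {0<..})" by (simp add: T_def image_image)
  moreover have "convex ((\<lambda>\<mu>::real. \<mu> *\<^sub>R v) ` {0<..})"
    by (intro convex_linear_image linear_scaleR_left) simp
  ultimately have "convex T" by (simp add: convex_translation)
  moreover have "T \<noteq> {}" "T \<inter> interior K = {}" using out by (auto simp: T_def)
  ultimately obtain u b where u: "u \<noteq> 0" "\<And>x. x \<in> K \<Longrightarrow> u \<bullet> x \<le> b" "\<And>x. x \<in> T \<Longrightarrow> b \<le> u \<bullet> x"
    using convex_supporting_separation[OF K'(1,2)] by metis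
  have uT: "b \<le> u \<bullet> q + \<mu> * (u \<bullet> v)" if "\<mu> > 0" for \<mu>
    using u(3)[of "q + \<mu> *\<^sub>R v"] that by (auto simp: T_def inner_add_right)
  have "((\<lambda>\<mu>. u \<bullet> q + \<mu> * (u \<bullet> v)) \<longlongrightarrow> u \<bullet> q + 0 * (u \<bullet> v)) (at_right 0)"
    by (intro tendsto_intros)
  moreover have "eventually (\<lambda>\<mu>. b \<le> u \<bullet> q + \<mu> * (u \<bullet> v)) (at_right 0)"
    using uT by (auto simp: eventually_at_filter)
  ultimately have "b \<le> u \<bullet> q + 0 * (u \<bullet> v)"
    by (intro tendsto_lowerbound) auto
  then have b: "b = u \<bullet> q" using u(2)[OF qK] by simp
  have uv: "u \<bullet> v \<ge> 0" using uT[of 1] by (simp add: b)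
  have a0: "a \<noteq> 0" using v by auto
  have "supporting_hyperplane_at K q {x. u \<bullet> x = u \<bullet> q}"
    "supporting_hyperplane_at K q {x. a \<bullet> x = a \<bullet> q}"
    unfolding supporting_hyperplane_at_def using u a a0 unfolding b outer_unit_normal_def by blast+
  then have eq: "{x. u \<bullet> x = u \<bullet> q} = {x. a \<bullet> x = a \<bullet> q}"
    using q unfolding regular_boundary_point_def by blast
  have na: "a \<bullet> a = 1" using a by (simp add: outer_unit_normal_def norm_eq_1)
  \<comment> \<open>Equal hyperplanes have parallel normals: the component \<open>w\<close> of \<open>u\<close> orthogonal to \<open>a\<close> vanishes.\<close>
  define \<gamma> where "\<gamma> = u \<bullet> a"
  define w where "w = u - \<gamma> *\<^sub>R a"
  have aw: "a \<bullet> w = 0" by (simp add: w_def \<gamma>_def inner_diff_right na inner_commute)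
  then have "q + w \<in> {x. u \<bullet> x = u \<bullet> q}" unfolding eq by (simp add: inner_add_right)
  then have "u \<bullet> w = 0" by (simp add: inner_add_right)
  moreover have "w \<bullet> w = u \<bullet> w - \<gamma> * (a \<bullet> w)"
    using inner_diff_left[of u "\<gamma> *\<^sub>R a" w] by (simp add: w_def)
  ultimately have "w = 0" using aw by simp
  then have ua: "u = \<gamma> *\<^sub>R a" by (simp add: w_def)
  have u_inner: "u \<bullet> x = \<gamma> * (a \<bullet> x)" for x by (subst ua) simp
  have "\<gamma> \<le> 0" using uv v unfolding u_inner by (simp add: zero_le_mult_iff)
  moreover have "\<gamma> \<noteq> 0" using ua u(1) by auto
  ultimately have neg: "\<gamma> < 0" by simp
  have "K \<subseteq> {x. a \<bullet> x = a \<bullet> q}"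
  proof
    fix x assume x: "x \<in> K"
    have "\<gamma> * (a \<bullet> x) \<le> \<gamma> * (a \<bullet> q)" using u(2)[OF x] b by (simp add: u_inner)
    then have "a \<bullet> q \<le> a \<bullet> x" using neg by simp
    moreover have "a \<bullet> x \<le> a \<bullet> q" using a x by (simp add: outer_unit_normal_def)
    ultimately show "x \<in> {x. a \<bullet> x = a \<bullet> q}" by simp
  qed
  then have "interior K \<subseteq> interior {x. a \<bullet> x = a \<bullet> q}" by (rule interior_mono)
  then show False using K'(2) a0 by (simp add: interior_hyperplane)
qed

text \<open>
  The copies of \<open>K\<close> enlarged around \<open>q\<close> by the factor \<open>1 / \<epsilon> n\<close> exhaust the open halfspace on the inner
  side. The sequence \<open>x\<close> instead of a single point is what the limit argument for
  tuples of points needs.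
\<close>
lemma regular_point_eventually_in_dilates:
  fixes K :: "'a::euclidean_space set"
  assumes K: "convex_body K" and q: "regular_boundary_point K q" and a: "outer_unit_normal K q a"
    and x: "x \<longlonglongrightarrow> l" and \<epsilon>: "\<epsilon> \<longlonglongrightarrow> 0" "\<And>n. \<epsilon> n > 0" and l: "a \<bullet> l < 0"
  shows "\<forall>\<^sub>F n in sequentially. q + \<epsilon> n *\<^sub>R x n \<in> K"
proof -
  obtain \<mu> where \<mu>: "\<mu> > 0" "q + \<mu> *\<^sub>R l \<in> interior K"
    using regular_point_inward_direction[OF K q a l] by blast
  have K': "convex K" "closed K" using K by (auto simp: convex_body_def compact_imp_closed)
  have qK: "q \<in> K" using q K'(2) by (auto simp: regular_boundary_point_def frontier_def)
  have "(\<lambda>n. q + \<mu> *\<^sub>R x n) \<longlonglongrightarrow> q + \<mu> *\<^sub>R l" by (intro tendsto_intros x)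
  then have "\<forall>\<^sub>F n in sequentially. q + \<mu> *\<^sub>R x n \<in> interior K"
    using topological_tendstoD \<mu>(2) open_interior by blast
  moreover have "\<forall>\<^sub>F n in sequentially. \<epsilon> n < \<mu>" using order_tendstoD(2)[OF \<epsilon>(1) \<mu>(1)] .
  ultimately show ?thesis
  proof eventually_elim
    case (elim n)
    have "(1 - \<epsilon> n / \<mu>) *\<^sub>R q + (\<epsilon> n / \<mu>) *\<^sub>R (q + \<mu> *\<^sub>R x n) \<in> K"
      using K'(1) qK elim \<mu>(1) \<epsilon>(2)[of n] interior_subset
      by (intro convexD) (auto simp: less_imp_le)
    then show ?case using \<mu>(1) by (simp add: algebra_simps)
  qed
qed

section \<open>Tuples of points in a compact set\<close>

lemma simultaneous_convergent_subsequence: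
  fixes f :: "nat \<Rightarrow> nat \<Rightarrow> 'a::metric_space"
  assumes X: "compact X" and f: "\<And>n i. f n i \<in> X"
  shows "\<exists>r l. strict_mono (r :: nat \<Rightarrow> nat) \<and> (\<forall>i<k. l i \<in> X \<and> (\<lambda>n. f (r n) i) \<longlonglongrightarrow> l i)"
proof (induction k)
  case 0
  show ?case using strict_mono_id by auto
next
  case (Suc k)
  then obtain r l where rl: "strict_mono r" "\<And>i. i < k \<Longrightarrow> l i \<in> X \<and> (\<lambda>n. f (r n) i) \<longlonglongrightarrow> l i"
    by blast
  obtain m s where s: "m \<in> X" "strict_mono s" "((\<lambda>n. f (r n) k) \<circ> s) \<longlonglongrightarrow> m"
    using X f unfolding compact_def by (metis (no_types, lifting))
  have "(l(k := m)) i \<in> X \<and> (\<lambda>n. f ((r \<circ> s) n) i) \<longlonglongrightarrow> (l(k := m)) i" if "i < Suc k" for i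
  proof (cases "i = k")
    case True
    then show ?thesis using s by (simp add: o_def)
  next
    case False
    then have "i < k" using that by simp
    then show ?thesis
      using rl(2) LIMSEQ_subseq_LIMSEQ[OF _ s(2), of "\<lambda>n. f (r n) i" "l i"] by (simp add: o_def)
  qed
  then show ?case using strict_mono_o[OF rl(1) s(2)] by blast
qed

text \<open>
  Repetitions and points outside \<open>Y\<close> are harmless, since hulls only grow; they allow all sets of at
  most \<open>k\<close> points to be treated as \<open>k\<close>-tuples.
\<close>
lemma finite_subset_enumeration:
  assumes "finite Y" "card Y \<le> k" "Y \<subseteq> X" "X \<noteq> {}"
  obtains f :: "nat \<Rightarrow> 'a" where "\<And>i. f i \<in> X" "Y \<subseteq> f ` {..<k}"
proof -
  obtain h where h: "bij_betw h {0..<card Y} Y" using ex_bij_betw_nat_finite assms(1) by blast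
  obtain x where x: "x \<in> X" using assms(4) by blast
  define f where "f i = (if i < card Y then h i else x)" for i
  have "h i \<in> Y" if "i < card Y" for i using h that by (auto simp: bij_betw_def)
  then have "f i \<in> X" for i using x assms(3) by (auto simp: f_def)
  moreover have "Y \<subseteq> f ` {..<k}"
  proof -
    have "Y = f ` {0..<card Y}" using h by (auto simp: bij_betw_def f_def)
    also have "\<dots> \<subseteq> f ` {..<k}" using assms(2) by (intro image_mono) auto
    finally show ?thesis .
  qed
  ultimately show thesis using that by blast
qed

section \<open>Comparison of the two hulls\<close>

text \<open>
  Every translate of \<open>K\<close> is an intersection of halfspaces with normals in \<open>normals K\<close>, and scaling does
  not change the directions of normals.
\<close>
lemma conv_H_scaled_in_conv_K:
  fixes K :: "'a::euclidean_space set"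
  assumes K: "convex_body K" and p: "p \<in> conv_H (normals K) X" and c: "c > 0"
  shows "c *\<^sub>R p \<in> conv_K K ((*\<^sub>R) c ` X)"
proof (rule ccontr)
  assume "c *\<^sub>R p \<notin> conv_K K ((*\<^sub>R) c ` X)"
  then obtain t where t: "(*\<^sub>R) c ` X \<subseteq> (+) t ` K" "c *\<^sub>R p \<notin> (+) t ` K"
    unfolding conv_K_eq by blast
  have "c *\<^sub>R p - t \<notin> K"
  proof
    assume "c *\<^sub>R p - t \<in> K"
    then have "t + (c *\<^sub>R p - t) \<in> (+) t ` K" by (rule imageI)
    then show False using t(2) by simp
  qed
  then obtain a b where a: "a \<in> normals K" "\<And>x. x \<in> K \<Longrightarrow> a \<bullet> x \<le> b" "b < a \<bullet> (c *\<^sub>R p - t)"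
    using convex_body_separation_by_normal[OF K] by blast
  have "X \<subseteq> {x. a \<bullet> x \<le> (b + a \<bullet> t) / c}"
  proof
    fix x assume "x \<in> X"
    then obtain k where "k \<in> K" "c *\<^sub>R x = t + k" using t(1) by blast
    then have "a \<bullet> (c *\<^sub>R x) \<le> a \<bullet> t + b" using a(2) by (simp only: inner_add_right) simp
    then show "x \<in> {x. a \<bullet> x \<le> (b + a \<bullet> t) / c}" using c by (simp add: field_simps)
  qed
  then have "a \<bullet> p \<le> (b + a \<bullet> t) / c" using p a(1) unfolding conv_H_eq by blast
  then show False using a(3) c by (simp add: inner_diff_right field_simps)
qed

lemma small_copies_in_translate:
  fixes K :: "'a::euclidean_space set"
  assumes K: "interior K \<noteq> {}" and X: "bounded X"
  obtains c t where "c > 0" "\<And>d. 0 < d \<Longrightarrow> d \<le> c \<Longrightarrow> (*\<^sub>R) d ` X \<subseteq> (+) t ` K"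
proof -
  obtain z r where z: "r > 0" "cball z r \<subseteq> K"
    using K by (metis ex_in_conv mem_interior_cball)
  obtain R where R: "R > 0" "\<And>x. x \<in> X \<Longrightarrow> norm x \<le> R" using X bounded_pos by blast
  have "(*\<^sub>R) d ` X \<subseteq> (+) (- z) ` K" if d: "0 < d" "d \<le> r / R" for d
  proof
    fix y assume "y \<in> (*\<^sub>R) d ` X"
    then obtain x where x: "x \<in> X" "y = d *\<^sub>R x" by blast
    have "norm y \<le> r / R * R"
      unfolding x(2) norm_scaleR using d R(1) R(2)[OF x(1)] by (intro mult_mono) auto
    then have "z + y \<in> K" using z R(1) by (auto simp: subset_iff dist_norm)
    then have "- z + (z + y) \<in> (+) (- z) ` K" by (rule imageI)
    then show "y \<in> (+) (- z) ` K" by simp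
  qed
  moreover have "r / R > 0" using z R by simp
  ultimately show thesis using that by blast
qed

text \<open>
  Suppose that a halfspace with normal \<open>a\<close> contains the limit points but not \<open>p\<close>. Translate \<open>K\<close>
  so that a regular boundary point with normal \<open>a\<close> sits at \<open>\<epsilon> n *\<^sub>R w\<close>, where \<open>w\<close> is strictly between
  the halfspace and \<open>p\<close>. For large \<open>n\<close> the translate contains the scaled points but not the scaled \<open>p\<close>.
\<close>
lemma conv_H_of_limit_of_conv_K:
  fixes K :: "'a::euclidean_space set"
  assumes K: "convex_body K" and \<epsilon>: "\<epsilon> \<longlonglongrightarrow> 0" "\<And>n. \<epsilon> n > 0"
    and x: "\<And>i. i < k \<Longrightarrow> (\<lambda>n. x n i) \<longlonglongrightarrow> l i"
    and p: "\<And>n. \<epsilon> n *\<^sub>R p \<in> conv_K K ((\<lambda>i. \<epsilon> n *\<^sub>R x n i) ` {..<(k::nat)})"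
  shows "p \<in> conv_H (normals K) (l ` {..<k})"
proof -
  have "a \<bullet> p \<le> b" if aH: "a \<in> normals K" and b: "l ` {..<k} \<subseteq> {x. a \<bullet> x \<le> b}" for a b
  proof (rule ccontr)
    assume "\<not> a \<bullet> p \<le> b"
    then have pb: "b < a \<bullet> p" by simp
    obtain q where q: "regular_boundary_point K q" "outer_unit_normal K q a"
      using aH unfolding normals_def by blast
    have aa: "a \<bullet> a = 1" using q(2) by (simp add: outer_unit_normal_def norm_eq_1)
    define w where "w = p - ((a \<bullet> p - b) / 2) *\<^sub>R a"
    have aw: "b < a \<bullet> w" "a \<bullet> w < a \<bullet> p" using pb by (simp_all add: w_def inner_diff_right aa field_simps)
    have "\<forall>\<^sub>F n in sequentially. q + \<epsilon> n *\<^sub>R (x n i - w) \<in> K" if i: "i < k" for i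
    proof (rule regular_point_eventually_in_dilates[OF K q _ \<epsilon>])
      show "(\<lambda>n. x n i - w) \<longlonglongrightarrow> l i - w" by (intro tendsto_intros x i)
      show "a \<bullet> (l i - w) < 0" using b i aw(1) by (force simp: inner_diff_right)
    qed
    then have "\<forall>\<^sub>F n in sequentially. \<forall>i\<in>{..<k}. q + \<epsilon> n *\<^sub>R (x n i - w) \<in> K"
      by (intro eventually_ball_finite) auto
    then obtain n where n: "\<And>i. i < k \<Longrightarrow> q + \<epsilon> n *\<^sub>R (x n i - w) \<in> K"
      using eventually_happens by fastforce
    define t where "t = \<epsilon> n *\<^sub>R w - q"
    have "(\<lambda>i. \<epsilon> n *\<^sub>R x n i) ` {..<k} \<subseteq> (+) t ` K"
    proof safe
      fix i assume "i < k"
      from n[OF this] have "t + (q + \<epsilon> n *\<^sub>R (x n i - w)) \<in> (+) t ` K" by (rule imageI)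
      then show "\<epsilon> n *\<^sub>R x n i \<in> (+) t ` K" by (simp add: t_def algebra_simps)
    qed
    then have "\<epsilon> n *\<^sub>R p \<in> (+) t ` K" using p[of n] unfolding conv_K_eq by blast
    then obtain y where y: "y \<in> K" "\<epsilon> n *\<^sub>R p = t + y" by blast
    then have "y = q + \<epsilon> n *\<^sub>R (p - w)" by (simp add: t_def algebra_simps)
    moreover have "a \<bullet> y \<le> a \<bullet> q" using q(2) y(1) by (simp add: outer_unit_normal_def)
    ultimately have "\<epsilon> n * (a \<bullet> (p - w)) \<le> 0" by (simp add: inner_add_right)
    then show False using \<epsilon>(2)[of n] aw(2) by (simp add: mult_le_0_iff inner_diff_right)
  qed
  then show ?thesis unfolding conv_H_eq by blast
qed

text \<open>
  This carries the Caratheodory property over: the \<open>k\<close> points found for smaller and smaller copies of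
  \<open>X\<close> are pulled back to \<open>X\<close>, where compactness yields limit points.
\<close>
lemma conv_H_caratheodory:
  fixes K :: "'a::euclidean_space set"
  assumes K: "convex_body K"
    and k: "\<And>X. closed X \<Longrightarrow> \<exists>t. X \<subseteq> (+) t ` K \<Longrightarrow>
      conv_K K X = (\<Union>X'\<in>{X'. X' \<subseteq> X \<and> finite X' \<and> card X' \<le> k}. conv_K K X')"
    and X: "compact X" and p: "p \<in> conv_H (normals K) X"
  obtains Y where "Y \<subseteq> X" "finite Y" "card Y \<le> k" "p \<in> conv_H (normals K) Y"
proof (cases "X = {}")
  case True
  then show thesis using that[of "{}"] p by simp
next
  case False
  obtain c t where c: "c > 0" "\<And>d. 0 < d \<Longrightarrow> d \<le> c \<Longrightarrow> (*\<^sub>R) d ` X \<subseteq> (+) t ` K"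
    using small_copies_in_translate[of K X] K X
    by (auto simp: convex_body_def compact_imp_bounded)
  define \<epsilon> where "\<epsilon> n = c / real (Suc n)" for n
  have \<epsilon>: "\<epsilon> \<longlonglongrightarrow> 0" "\<And>n. 0 < \<epsilon> n" "\<And>n. \<epsilon> n \<le> c"
    using c(1) LIMSEQ_Suc[OF lim_const_over_n, of c] unfolding \<epsilon>_def by (auto simp: field_simps)
  have "\<exists>f. (\<forall>i. f i \<in> X) \<and> \<epsilon> n *\<^sub>R p \<in> conv_K K ((\<lambda>i. \<epsilon> n *\<^sub>R f i) ` {..<k})" for n
  proof -
    have "\<epsilon> n *\<^sub>R p \<in> conv_K K ((*\<^sub>R) (\<epsilon> n) ` X)"
      using conv_H_scaled_in_conv_K[OF K p \<epsilon>(2)] .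
    moreover have "closed ((*\<^sub>R) (\<epsilon> n) ` X)"
      using X by (simp add: closed_scaling compact_imp_closed)
    ultimately obtain Z where Z: "Z \<subseteq> (*\<^sub>R) (\<epsilon> n) ` X" "finite Z" "card Z \<le> k" "\<epsilon> n *\<^sub>R p \<in> conv_K K Z"
      using k[of "(*\<^sub>R) (\<epsilon> n) ` X"] c(2)[OF \<epsilon>(2,3), of n] by blast
    obtain g where g: "\<And>i. g i \<in> (*\<^sub>R) (\<epsilon> n) ` X" "Z \<subseteq> g ` {..<k}"
      using finite_subset_enumeration[OF Z(2,3,1)] False by blast
    then have "\<forall>i. \<exists>x. x \<in> X \<and> g i = \<epsilon> n *\<^sub>R x" by blast
    then obtain f where f: "\<And>i. f i \<in> X" "\<And>i. g i = \<epsilon> n *\<^sub>R f i" by metis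
    have "conv_K K Z \<subseteq> conv_K K (g ` {..<k})" unfolding conv_K_def using g(2) by (rule hull_mono)
    then show ?thesis using f Z(4) by auto
  qed
  then obtain f where f: "\<And>n i. f n i \<in> X"
    "\<And>n. \<epsilon> n *\<^sub>R p \<in> conv_K K ((\<lambda>i. \<epsilon> n *\<^sub>R f n i) ` {..<k})" by metis
  obtain r l where r: "strict_mono r" "\<And>i. i < k \<Longrightarrow> l i \<in> X \<and> (\<lambda>n. f (r n) i) \<longlonglongrightarrow> l i"
    using simultaneous_convergent_subsequence[OF X, of f k] f(1) by blast
  have "p \<in> conv_H (normals K) (l ` {..<k})"
  proof (rule conv_H_of_limit_of_conv_K[OF K, where \<epsilon> = "\<epsilon> \<circ> r" and x = "\<lambda>n. f (r n)"])
    show "(\<epsilon> \<circ> r) \<longlonglongrightarrow> 0" using LIMSEQ_subseq_LIMSEQ[OF \<epsilon>(1) r(1)] .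
  qed (use \<epsilon>(2) r(2) f(2) in auto)
  moreover have "l ` {..<k} \<subseteq> X" using r(2) by blast
  moreover have "card (l ` {..<k}) \<le> k" using card_image_le[of "{..<k}" l] by simp
  ultimately show thesis using that[of "l ` {..<k}"] by blast
qed

section \<open>Comparison of the Caratheodory numbers\<close>

theorem theorem2:
  fixes K :: "'a::euclidean_space set"
  assumes "convex_body K"
  shows "caratheodory_number_K K \<ge> caratheodory_number_H (normals K)"
proof -
  define small where "small k X = {X'. X' \<subseteq> X \<and> finite X' \<and> card X' \<le> k}" for k and X :: "'a set"
  define k_good where "k_good k \<longleftrightarrow> (\<forall>X. closed X \<and> (\<exists>t. X \<subseteq> (+) t ` K) \<longrightarrow>
      conv_K K X = (\<Union>X'\<in>small k X. conv_K K X'))" for k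
  define h_good where "h_good k \<longleftrightarrow> (\<forall>X. closed X \<and> bounded X \<longrightarrow>
      conv_H (normals K) X = (\<Union>X'\<in>small k X. conv_H (normals K) X'))" for k
  have good: "h_good k" if k: "k_good k" for k
    unfolding h_good_def
  proof (intro allI impI subset_antisym)
    fix X :: "'a set" assume "closed X \<and> bounded X"
    then have X: "compact X" by (simp add: compact_eq_bounded_closed)
    show "conv_H (normals K) X \<subseteq> (\<Union>X'\<in>small k X. conv_H (normals K) X')"
    proof
      fix p assume p: "p \<in> conv_H (normals K) X"
      have "conv_K K Z = (\<Union>X'\<in>{X'. X' \<subseteq> Z \<and> finite X' \<and> card X' \<le> k}. conv_K K X')"
        if "closed Z" "\<exists>t. Z \<subseteq> (+) t ` K" for Z
        using k that unfolding k_good_def small_def by simp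
      from conv_H_caratheodory[OF assms this X p]
      obtain Y where "Y \<subseteq> X" "finite Y" "card Y \<le> k" "p \<in> conv_H (normals K) Y" .
      then show "p \<in> (\<Union>X'\<in>small k X. conv_H (normals K) X')" unfolding small_def by blast
    qed
    show "(\<Union>X'\<in>small k X. conv_H (normals K) X') \<subseteq> conv_H (normals K) X"
      unfolding conv_H_def small_def by (intro UN_least hull_mono) simp
  qed
  have "Inf {enat k | k. h_good k} \<le> Inf {enat k | k. k_good k}"
  proof (rule Inf_superset_mono)
    show "{enat k | k. k_good k} \<subseteq> {enat k | k. h_good k}" using good by auto
  qed
  then show ?thesis
    unfolding caratheodory_number_H_def caratheodory_number_K_def caratheodory_number_def
      h_good_def k_good_def small_def .
qed

end
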